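(* Let $X$ and $\Xi$ be compact metric spaces, let $\tau:\Xi\to\Xi$ be an equicontinuous homeomorphism, and let the homeomorphism $f:X\to X$ be a minimal almost 1-1 extension of $\tau$ with non-injective factor map. Then there exists $\delta>0$ such that $\sup_{n\in\mathbb{N}}S_n(f,\delta)=\infty$.
   Context: $f:X\to X$ is an extension of $\tau:\Xi\to\Xi$ if there is a continuous surjective map $h:X\to\Xi$ (the factor map) with $h\circ f=\tau\circ h$. The extension is almost 1-1 if the set $\{\xi\in\Xi\mid\#h^{-1}(\xi)=1\}$ is residual in $\Xi$. It is a minimal extension if $f$ is minimal (so $\tau$ is minimal as well). A homeomorphism $\tau$ is equicontinuous (almost periodic) if the family of its iterates is equicontinuous. With $d$ the metric on $X$ and $n\geq1$, the Bowen-Dinaburg metric is $d_n^f(x,y)=\max_{0\leq i\leq n-1}d(f^i(x),f^i(y))$, and $S_n(f,\delta)$ denotes the maximal cardinality of a set $S\subseteq X$ with $d_n^f(x,y)\geq\delta$ for all $x\neq y$ in $S$. *)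

theory Defs
  imports "HOL-Analysis.Analysis" "HOL-Library.Extended_Nat"
begin

text \<open>Spaces are subsets of a metric space type, with the induced metric and topology;
  only the restriction of a map to its space matters.\<close>

definition factor_map_on ::
  "'a::metric_space set \<Rightarrow> ('a \<Rightarrow> 'a) \<Rightarrow> 'b::metric_space set \<Rightarrow> ('b \<Rightarrow> 'b) \<Rightarrow> ('a \<Rightarrow> 'b) \<Rightarrow> bool"
  where "factor_map_on X f \<Xi> \<tau> h \<longleftrightarrow>
    continuous_on X h \<and> h ` X = \<Xi> \<and> (\<forall>x\<in>X. h (f x) = \<tau> (h x))"

definition residual_in :: "'a topology \<Rightarrow> 'a set \<Rightarrow> bool"
  where "residual_in T A \<longleftrightarrow> A \<subseteq> topspace T \<and>
    (\<exists>\<G>. countable \<G> \<and> (\<forall>G\<in>\<G>. openin T G \<and> T closure_of G = topspace T) \<and>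
         topspace T \<inter> \<Inter>\<G> \<subseteq> A)"

definition almost_one_one_on :: "'a set \<Rightarrow> 'b::metric_space set \<Rightarrow> ('a \<Rightarrow> 'b) \<Rightarrow> bool"
  where "almost_one_one_on X \<Xi> h \<longleftrightarrow>
    residual_in (top_of_set \<Xi>) {\<xi>\<in>\<Xi>. card {x\<in>X. h x = \<xi>} = 1}"

definition minimal_on :: "'a::metric_space set \<Rightarrow> ('a \<Rightarrow> 'a) \<Rightarrow> bool"
  where "minimal_on X f \<longleftrightarrow> X \<noteq> {} \<and> f ` X \<subseteq> X \<and>
    (\<forall>A. closedin (top_of_set X) A \<longrightarrow> A \<noteq> {} \<longrightarrow> f ` A \<subseteq> A \<longrightarrow> A = X)"

definition equicontinuous_family_on :: "'a::metric_space set \<Rightarrow> ('a \<Rightarrow> 'b::metric_space) set \<Rightarrow> bool"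
  where "equicontinuous_family_on X F \<longleftrightarrow>
    (\<forall>x\<in>X. \<forall>\<epsilon>>0. \<exists>\<delta>>0. \<forall>g\<in>F. \<forall>y\<in>X. dist x y < \<delta> \<longrightarrow> dist (g x) (g y) < \<epsilon>)"

definition equicontinuous_map_on :: "'a::metric_space set \<Rightarrow> ('a \<Rightarrow> 'a) \<Rightarrow> bool"
  where "equicontinuous_map_on X f \<longleftrightarrow> equicontinuous_family_on X (range (\<lambda>n. f ^^ n))"

text \<open>Meaningful for \<open>n \<ge> 1\<close> only (by truncated subtraction, \<open>n = 0\<close> gives the value at \<open>n = 1\<close>).\<close>

definition bowen_dist :: "('a::metric_space \<Rightarrow> 'a) \<Rightarrow> nat \<Rightarrow> 'a \<Rightarrow> 'a \<Rightarrow> real"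
  where "bowen_dist f n x y = (MAX i\<in>{0..n - 1}. dist ((f ^^ i) x) ((f ^^ i) y))"

text \<open>The maximal cardinality of a \<open>\<delta>\<close>-separated set, as an extended natural number. Since subsets
  of separated sets are separated, ranging over finite sets loses nothing: the value is the
  maximum whenever the cardinalities are bounded, and \<open>\<infinity>\<close> otherwise. It avoids
  \<open>card S = 0\<close> for infinite \<open>S\<close>.\<close>

definition sep_number :: "'a::metric_space set \<Rightarrow> ('a \<Rightarrow> 'a) \<Rightarrow> nat \<Rightarrow> real \<Rightarrow> enat"
  where "sep_number X f n \<delta> =
    (SUP S\<in>{S. S \<subseteq> X \<and> finite S \<and> (\<forall>x\<in>S. \<forall>y\<in>S. x \<noteq> y \<longrightarrow> bowen_dist f n x y \<ge> \<delta>)}. enat (card S))"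

end

theory Submission
  imports Defs
begin

text \<open>If the separation numbers at scale \<open>\<delta>\<close> are bounded, a separated set of maximal
  cardinality shows that finitely many closed sets of points with uniformly \<open>\<delta>\<close>-close forward
  orbits cover \<open>X\<close>. Near a given point only the members of this cover containing that point
  matter, so \<open>f\<close> is equicontinuous at every point, up to \<open>2\<delta>\<close>. On the other hand, two points
  \<open>x \<noteq> y\<close> of one fibre have backward iterates arbitrarily close to the point \<open>x0\<close> of a singleton
  fibre. Running forward from there separates two orbits that start close to \<open>x0\<close>, which is
  impossible for \<open>\<delta>\<close> small compared to \<open>dist x y\<close>.\<close>

text \<open>By the Baire category theorem the countable intersection witnessing residuality is
  dense, and a dense subset of a nonempty space is nonempty.\<close>

lemma residual_in_nonempty:
  assumes "residual_in T A" "topspace T \<noteq> {}"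
    and "completely_metrizable_space T \<or> locally_compact_space T \<and> regular_space T"
  shows "A \<noteq> {}"
proof -
  obtain \<G> where "countable \<G>" 
    and \<G>: "\<And>G. G \<in> \<G> \<Longrightarrow> openin T G \<and> T closure_of G = topspace T"
    and sub: "topspace T \<inter> \<Inter>\<G> \<subseteq> A"
    using assms(1) unfolding residual_in_def by blast
  then have "T closure_of \<Inter>\<G> = topspace T"
    using Baire_category[OF assms(3)] by blast
  then have "topspace T \<inter> \<Inter>\<G> \<noteq> {}"
    using assms(2) by (metis closure_of_empty closure_of_restrict)
  then show ?thesis
    using sub by blast
qed

lemma bowen_dist_ge_iff:
  "\<delta> \<le> bowen_dist f n x y \<longleftrightarrow> (\<exists>i\<le>n - 1. \<delta> \<le> dist ((f ^^ i) x) ((f ^^ i) y))"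
  unfolding bowen_dist_def by (subst Max_ge_iff) auto

text \<open>The time separating two points may depend on the pair. A finite set has finitely many
  pairs, so the latest such time gives one Bowen metric that separates them all.\<close>

lemma card_le_SUP_sep_number:
  assumes "S \<subseteq> X" "finite S"
    and sep: "\<And>x y. x \<in> S \<Longrightarrow> y \<in> S \<Longrightarrow> x \<noteq> y \<Longrightarrow> \<exists>i. \<delta> \<le> dist ((f ^^ i) x) ((f ^^ i) y)"
  shows "enat (card S) \<le> (SUP n\<in>{1..}. sep_number X f n \<delta>)"
proof -
  obtain k where k: "\<And>x y. x \<in> S \<Longrightarrow> y \<in> S \<Longrightarrow> x \<noteq> y \<Longrightarrow>
      \<delta> \<le> dist ((f ^^ k x y) x) ((f ^^ k x y) y)"
    using sep by metis
  define m where "m = Max (insert 0 ((\<lambda>(x, y). k x y) ` (S \<times> S)))"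
  have "k x y \<le> m" if "x \<in> S" "y \<in> S" for x y
    unfolding m_def using that \<open>finite S\<close> by (intro Max_ge) auto
  \<comment> \<open>\<open>bowen_dist f n\<close> only looks at times up to \<open>n - 1\<close>,
    hence \<open>Suc m\<close>.\<close>
  then have "\<delta> \<le> bowen_dist f (Suc m) x y" if "x \<in> S" "y \<in> S" "x \<noteq> y" for x y
    unfolding bowen_dist_ge_iff using k that by (metis diff_Suc_1)
  then have "enat (card S) \<le> sep_number X f (Suc m) \<delta>"
    unfolding sep_number_def using assms(1,2) by (intro SUP_upper) auto
  also have "\<dots> \<le> (SUP n\<in>{1..}. sep_number X f n \<delta>)"
    by (rule SUP_upper) auto
  finally show ?thesis .
qed

text \<open>A separated set of maximal cardinality works: a point whose orbit leaves the closed
  \<open>\<delta>\<close>-tube around the orbit of each member could be added to it.\<close>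

lemma finite_orbit_cover:
  assumes "(SUP n\<in>{1..}. sep_number X f n \<delta>) \<noteq> \<infinity>" "\<delta> > 0"
  obtains S where "finite S" "S \<subseteq> X"
    and "\<And>x. x \<in> X \<Longrightarrow> \<exists>s\<in>S. \<forall>i. dist ((f ^^ i) x) ((f ^^ i) s) \<le> \<delta>"
proof -
  define P where "P S \<longleftrightarrow> S \<subseteq> X \<and> finite S \<and>
    (\<forall>x\<in>S. \<forall>y\<in>S. x \<noteq> y \<longrightarrow> (\<exists>i. \<delta> \<le> dist ((f ^^ i) x) ((f ^^ i) y)))" for S
  obtain N where N: "(SUP n\<in>{1..}. sep_number X f n \<delta>) = enat N"
    using assms(1) by blast
  have "card S < Suc N" if "P S" for S
    using card_le_SUP_sep_number[of S X \<delta> f] that unfolding P_def N by auto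
  moreover have "P {}"
    unfolding P_def by simp
  ultimately obtain S where S: "P S" and max: "\<And>R. P R \<Longrightarrow> card R \<le> card S"
    using ex_has_greatest_nat[of P "{}" card "Suc N"] by blast
  have "\<exists>s\<in>S. \<forall>i. dist ((f ^^ i) x) ((f ^^ i) s) \<le> \<delta>" if "x \<in> X" for x
  proof (rule ccontr)
    assume "\<not> ?thesis"
    then have far: "\<exists>i. \<delta> < dist ((f ^^ i) x) ((f ^^ i) s)" if "s \<in> S" for s
      using that by (meson not_le)
    \<comment> \<open>Otherwise \<open>far\<close> with \<open>s = x\<close> would give
      \<open>\<delta> < 0\<close>.\<close>
    then have "x \<notin> S"
      using \<open>\<delta> > 0\<close> by force
    moreover have "P (insert x S)"
      using S \<open>x \<in> X\<close> far unfolding P_def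
      by (auto simp: dist_commute) (meson less_imp_le)+
    ultimately show False
      using max[of "insert x S"] S unfolding P_def by auto
  qed
  then show ?thesis
    using that S unfolding P_def by blast
qed

lemma continuous_on_funpow:
  assumes "continuous_on X f" "f ` X \<subseteq> X"
  shows "continuous_on X (f ^^ n) \<and> (f ^^ n) ` X \<subseteq> X"
proof (induction n)
  case (Suc n)
  then show ?case
    using assms by (auto intro: continuous_on_compose2)
qed (simp add: id_def)

lemma bounded_sep_number_imp_equicontinuous_at:
  assumes "compact X" "continuous_on X f" "f ` X \<subseteq> X"
    and "(SUP n\<in>{1..}. sep_number X f n \<delta>) \<noteq> \<infinity>" "\<delta> > 0" "p \<in> X"
  obtains V where "open V" "p \<in> V"
    and "\<And>u i. u \<in> V \<inter> X \<Longrightarrow> dist ((f ^^ i) u) ((f ^^ i) p) \<le> 2 * \<delta>"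
proof -
  obtain S where S: "finite S" "S \<subseteq> X"
    and cov: "\<And>x. x \<in> X \<Longrightarrow> \<exists>s\<in>S. \<forall>i. dist ((f ^^ i) x) ((f ^^ i) s) \<le> \<delta>"
    using finite_orbit_cover[OF assms(4,5)] by blast
  define B where "B s = (\<Inter>i. {x\<in>X. dist ((f ^^ i) x) ((f ^^ i) s) \<le> \<delta>})" for s
  have cont: "continuous_on X (f ^^ i)" for i
    using continuous_on_funpow[OF assms(2,3)] by blast
  have cl: "closed (B s)" for s
    unfolding B_def
    by (intro closed_INT ballI continuous_on_closed_Collect_le continuous_on_dist
        continuous_on_const cont compact_imp_closed[OF assms(1)])
  \<comment> \<open>Removing the finitely many members of the cover that miss \<open>p\<close>
    leaves an open set. Any member \<open>B s\<close> containing a point of it also contains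
    \<open>p\<close>, so \<open>s\<close> links the two orbits at cost
    \<open>\<delta> + \<delta>\<close>.\<close>
  define V where "V = - \<Union> (B ` {s\<in>S. p \<notin> B s})"
  have "open V"
    unfolding V_def using S cl by (intro open_Compl closed_UN) auto
  moreover have "p \<in> V"
    unfolding V_def by auto
  moreover have "dist ((f ^^ i) u) ((f ^^ i) p) \<le> 2 * \<delta>" if u: "u \<in> V \<inter> X" for u i
  proof -
    obtain s where "s \<in> S" and us: "\<And>i. dist ((f ^^ i) u) ((f ^^ i) s) \<le> \<delta>"
      using cov u by blast
    then have "u \<in> B s"
      using u unfolding B_def by auto
    then have "p \<in> B s"
      using u \<open>s \<in> S\<close> unfolding V_def by auto
    then have "dist ((f ^^ i) p) ((f ^^ i) s) \<le> \<delta>"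
      unfolding B_def by auto
    then show ?thesis
      using us[of i] dist_triangle2[of "(f ^^ i) u" "(f ^^ i) p" "(f ^^ i) s"] by linarith
  qed
  ultimately show ?thesis
    using that by blast
qed

text \<open>The set of limit points of a backward orbit is closed, nonempty and invariant under \<open>f\<close>
  (the backward orbit itself is not invariant), so it is all of \<open>X\<close>.\<close>

lemma minimal_on_backward_orbit_dense:
  assumes "compact X" "homeomorphism X X f f'" "minimal_on X f" "x \<in> X"
  shows "X \<subseteq> closure (range (\<lambda>n. (f' ^^ n) x))"
proof -
  define O\<^sub>b where "O\<^sub>b n = (\<lambda>m. (f' ^^ m) x) ` {n..}" for n
  define A where "A = (\<Inter>n. closure (O\<^sub>b n))"
  have f: "continuous_on X f" "\<And>z. z \<in> X \<Longrightarrow> f (f' z) = z" "\<And>z. z \<in> X \<Longrightarrow> f' z \<in> X"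
    using assms(2) unfolding homeomorphism_def by auto
  have inX: "(f' ^^ n) x \<in> X" for n
    by (induction n) (use assms(4) f in auto)
  have ObX: "closure (O\<^sub>b n) \<subseteq> X" for n
    using inX compact_imp_closed[OF assms(1)] by (intro closure_minimal) (auto simp: O\<^sub>b_def)
  have "A \<subseteq> X"
    unfolding A_def using ObX by blast
  have "closed A"
    unfolding A_def by auto
  obtain z r where "strict_mono (r :: nat \<Rightarrow> nat)" and lim: "((\<lambda>n. (f' ^^ n) x) \<circ> r) \<longlonglongrightarrow> z"
    using compact_imp_seq_compact[OF assms(1)] inX by (metis seq_compactE)
  have "z \<in> closure (O\<^sub>b n)" for n
  proof (rule Lim_in_closed_set[OF closed_closure _ _ lim])
    show "\<forall>\<^sub>F k in sequentially. ((\<lambda>n. (f' ^^ n) x) \<circ> r) k \<in> closure (O\<^sub>b n)"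
    proof (rule eventually_sequentiallyI)
      fix k assume "n \<le> k"
      then have "n \<le> r k"
        using seq_suble[OF \<open>strict_mono r\<close>, of k] by linarith
      then show "((\<lambda>n. (f' ^^ n) x) \<circ> r) k \<in> closure (O\<^sub>b n)"
        by (intro subsetD[OF closure_subset]) (auto simp: O\<^sub>b_def)
    qed
  qed simp
  then have "A \<noteq> {}"
    unfolding A_def by auto
  moreover have "f ` A \<subseteq> A"
  proof -
    \<comment> \<open>\<open>f\<close> undoes one step of \<open>f'\<close>, so it shifts the tail
      by one index. The loss disappears in the intersection over all tails.\<close>
    have "f ` closure (O\<^sub>b (Suc n)) \<subseteq> closure (O\<^sub>b n)" for n
    proof (rule image_closure_subset)
      show "continuous_on (closure (O\<^sub>b (Suc n))) f"
        using continuous_on_subset[OF f(1) ObX] .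
      have "f ((f' ^^ m) x) \<in> O\<^sub>b n" if "m \<ge> Suc n" for m
      proof -
        obtain j where "m = Suc j" "n \<le> j"
          using \<open>m \<ge> Suc n\<close> by (cases m) auto
        then show ?thesis
          using f(2)[OF inX] by (auto simp: O\<^sub>b_def)
      qed
      then show "f ` O\<^sub>b (Suc n) \<subseteq> closure (O\<^sub>b n)"
        using closure_subset by (fastforce simp: O\<^sub>b_def[of "Suc n"])
    qed simp
    then show ?thesis
      unfolding A_def by blast
  qed
  moreover have "closedin (top_of_set X) A"
    using \<open>closed A\<close> \<open>A \<subseteq> X\<close> by (simp add: closed_subset)
  ultimately have "A = X"
    using assms(3) unfolding minimal_on_def by blast
  moreover have "A \<subseteq> closure (O\<^sub>b 0)"
    unfolding A_def by blast
  ultimately show ?thesis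
    by (simp add: O\<^sub>b_def atLeast_0)
qed

text \<open>Backward iterates of \<open>x\<close> and \<open>y\<close> stay in a common fibre.
  Choose times at which those of \<open>x\<close> tend to \<open>p\<close>. Any limit
  \<open>q\<close> of those of \<open>y\<close> along these times satisfies
  \<open>h q = h p\<close>, and the singleton fibre forces \<open>q = p\<close>.\<close>

lemma fibre_backward_proximal:
  assumes X: "compact X" and f: "homeomorphism X X f f'" and "minimal_on X f"
    and "inj_on \<tau> \<Xi>" and h: "factor_map_on X f \<Xi> \<tau> h"
    and fib: "{z\<in>X. h z = h p} = {p}"
    and xy: "x \<in> X" "y \<in> X" "h x = h y" and V: "open V" "p \<in> V"
  shows "\<exists>n. (f' ^^ n) x \<in> V \<and> (f' ^^ n) y \<in> V"
proof -
  have f'X: "(f' ^^ n) z \<in> X" if "z \<in> X" for n z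
    by (induction n) (use that f in \<open>auto simp: homeomorphism_def\<close>)
  have h_eq: "h ((f' ^^ n) x) = h ((f' ^^ n) y)" for n
  proof (induction n)
    case (Suc n)
    \<comment> \<open>Equivariance is given for \<open>f\<close> only. Going backward, it holds
      after applying \<open>\<tau>\<close>, which injectivity then cancels.\<close>
    have "\<tau> (h ((f' ^^ Suc n) z)) = h ((f' ^^ n) z)" if "z \<in> X" for z
    proof -
      have "h (f ((f' ^^ Suc n) z)) = \<tau> (h ((f' ^^ Suc n) z))"
        using h f'X[OF that] unfolding factor_map_on_def by blast
      moreover have "f ((f' ^^ Suc n) z) = (f' ^^ n) z"
        using f f'X[OF that] by (simp add: homeomorphism_def)
      ultimately show ?thesis by simp
    qed
    then have "\<tau> (h ((f' ^^ Suc n) x)) = \<tau> (h ((f' ^^ Suc n) y))"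
      using Suc xy by simp
    moreover have "h ((f' ^^ Suc n) z) \<in> \<Xi>" if "z \<in> X" for z
      using h f'X[OF that] unfolding factor_map_on_def by blast
    ultimately show ?case
      using \<open>inj_on \<tau> \<Xi>\<close> xy unfolding inj_on_def by blast
  qed (simp add: xy)
  have "p \<in> X"
    using fib by blast
  then have "p \<in> closure (range (\<lambda>n. (f' ^^ n) x))"
    using minimal_on_backward_orbit_dense[OF X f \<open>minimal_on X f\<close> \<open>x \<in> X\<close>] by blast
  then obtain w where "\<And>k. w k \<in> range (\<lambda>n. (f' ^^ n) x)" and "w \<longlonglongrightarrow> p"
    unfolding closure_sequential by blast
  \<comment> \<open>The times \<open>c k\<close> need not increase. It only matters that the same
    times are used for \<open>y\<close>.\<close>
  then obtain c where wc: "\<And>k. w k = (f' ^^ c k) x"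
    unfolding image_iff by metis
  obtain q r where "q \<in> X" and r: "strict_mono (r :: nat \<Rightarrow> nat)"
    and limy: "((\<lambda>k. (f' ^^ c k) y) \<circ> r) \<longlonglongrightarrow> q"
    using seq_compactE[OF compact_imp_seq_compact[OF X], of "\<lambda>k. (f' ^^ c k) y"] f'X xy
    by blast
  have limx: "(w \<circ> r) \<longlonglongrightarrow> p"
    using \<open>w \<longlonglongrightarrow> p\<close> r by (rule LIMSEQ_subseq_LIMSEQ)
  have conth: "continuous_on X h"
    using h unfolding factor_map_on_def by blast
  have "(\<lambda>k. h ((w \<circ> r) k)) \<longlonglongrightarrow> h p"
    using f'X xy by (intro continuous_on_tendsto_compose[OF conth limx \<open>p \<in> X\<close>]) (simp add: wc)
  moreover have "(\<lambda>k. h (((\<lambda>k. (f' ^^ c k) y) \<circ> r) k)) \<longlonglongrightarrow> h q"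
    using f'X xy by (intro continuous_on_tendsto_compose[OF conth limy \<open>q \<in> X\<close>]) simp
  ultimately have "h p = h q"
    using LIMSEQ_unique by (simp add: wc h_eq)
  then have "q = p"
    using fib \<open>q \<in> X\<close> by auto
  have "\<forall>\<^sub>F k in sequentially. (w \<circ> r) k \<in> V \<and> ((\<lambda>k. (f' ^^ c k) y) \<circ> r) k \<in> V"
    using topological_tendstoD[OF limx V] topological_tendstoD[OF limy] V \<open>q = p\<close>
    by (simp add: eventually_conj)
  then obtain k where "(w \<circ> r) k \<in> V \<and> ((\<lambda>k. (f' ^^ c k) y) \<circ> r) k \<in> V"
    using eventually_happens by fastforce
  then show ?thesis
    by (auto simp: wc)
qed

theorem corollary6p5:
  fixes X :: "'a::metric_space set" and \<Xi> :: "'b::metric_space set"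
    and f f' :: "'a \<Rightarrow> 'a" and \<tau> \<tau>' :: "'b \<Rightarrow> 'b" and h :: "'a \<Rightarrow> 'b"
  assumes "compact X" and "compact \<Xi>"
    and "homeomorphism \<Xi> \<Xi> \<tau> \<tau>'" and "equicontinuous_map_on \<Xi> \<tau>"
    and "homeomorphism X X f f'" and "minimal_on X f"
    and "factor_map_on X f \<Xi> \<tau> h" and "almost_one_one_on X \<Xi> h"
    and "\<not> inj_on h X"
  shows "\<exists>\<delta>>0. (SUP n\<in>{1..}. sep_number X f n \<delta>) = \<infinity>"
proof -
  obtain x y where xy: "x \<in> X" "y \<in> X" "h x = h y" "x \<noteq> y"
    using assms(9) unfolding inj_on_def by blast
  have "{\<xi>\<in>\<Xi>. card {x\<in>X. h x = \<xi>} = 1} \<noteq> {}"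
  proof (rule residual_in_nonempty)
    show "residual_in (top_of_set \<Xi>) {\<xi>\<in>\<Xi>. card {x\<in>X. h x = \<xi>} = 1}"
      using assms(8) unfolding almost_one_one_on_def .
    show "topspace (top_of_set \<Xi>) \<noteq> {}"
      using xy assms(7) unfolding factor_map_on_def by auto
    show "completely_metrizable_space (top_of_set \<Xi>) \<or>
        locally_compact_space (top_of_set \<Xi>) \<and> regular_space (top_of_set \<Xi>)"
      using assms(2)
      by (simp add: compact_imp_locally_compact_space compact_space_subtopology
          regular_space_subtopology metrizable_imp_regular_space metrizable_space_euclidean)
  qed
  then obtain \<xi> where "card {x\<in>X. h x = \<xi>} = 1"
    by blast
  \<comment> \<open>As \<open>card\<close> is 0 on infinite sets, the value 1 does mean a singleton
    fibre.\<close>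
  then obtain p where fib: "{x\<in>X. h x = \<xi>} = {p}"
    by (rule card_1_singletonE)
  then have "p \<in> X" "h p = \<xi>"
    by blast+
  then have p: "{z\<in>X. h z = h p} = {p}"
    using fib by simp
  have inj: "inj_on \<tau> \<Xi>"
    using assms(3) unfolding homeomorphism_def by (metis inj_onI)
  have f: "continuous_on X f" "f ` X \<subseteq> X"
    and ff': "\<And>z. z \<in> X \<Longrightarrow> f (f' z) = z" "\<And>z. z \<in> X \<Longrightarrow> f' z \<in> X"
    using assms(5) unfolding homeomorphism_def by auto
  have f'X: "(f' ^^ n) z \<in> X" if "z \<in> X" for n z
    by (induction n) (use that ff' in auto)
  have cancel: "(f ^^ n) ((f' ^^ n) z) = z" if "z \<in> X" for n z
  proof (induction n)
    case (Suc n)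
    then show ?case
      using ff'(1)[OF f'X[OF that, of n]] by (simp add: funpow_swap1)
  qed simp
  \<comment> \<open>Below, \<open>x\<close> and \<open>y\<close> both come within
    \<open>2 * \<delta>\<close> of one point, so \<open>dist x y\<close> must exceed
    \<open>4 * \<delta>\<close>.\<close>
  define \<delta> where "\<delta> = dist x y / 5"
  have "\<delta> > 0"
    using xy by (simp add: \<delta>_def)
  moreover have "(SUP n\<in>{1..}. sep_number X f n \<delta>) = \<infinity>"
  proof (rule ccontr)
    assume bdd: "\<not> ?thesis"
    obtain V where V: "open V" "p \<in> V"
      and near: "\<And>u i. u \<in> V \<inter> X \<Longrightarrow> dist ((f ^^ i) u) ((f ^^ i) p) \<le> 2 * \<delta>"
      using bounded_sep_number_imp_equicontinuous_at[OF assms(1) f bdd \<open>\<delta> > 0\<close> \<open>p \<in> X\<close>]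
      by blast
    obtain n where n: "(f' ^^ n) x \<in> V" "(f' ^^ n) y \<in> V"
      using fibre_backward_proximal[OF assms(1,5,6) inj assms(7) p xy(1-3) V] by blast
    \<comment> \<open>Running the two nearby points forward for exactly \<open>n\<close> steps
      returns \<open>x\<close> and \<open>y\<close> themselves.\<close>
    have "dist x ((f ^^ n) p) \<le> 2 * \<delta>" "dist y ((f ^^ n) p) \<le> 2 * \<delta>"
      using near[of "(f' ^^ n) x" n] near[of "(f' ^^ n) y" n] n f'X cancel xy by auto
    then have "dist x y \<le> 4 * \<delta>"
      using dist_triangle2[of x y "(f ^^ n) p"] by linarith
    then show False
      using xy by (simp add: \<delta>_def)
  qed
  ultimately show ?thesis
    by blast
qed

end
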